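(* For every integer $n\geq 6$, there exists a 2-connected pseudo-outerplanar graph of order $n$ whose edge set cannot be partitioned into two forests.
   Context: All graphs are finite, simple and undirected. A block is a maximal 2-connected subgraph. A graph is pseudo-outerplanar if each of its blocks can be drawn in the plane so that its vertices lie on a fixed circle, its edges lie inside the disk bounded by that circle, and each edge crosses at most one other edge. *)

theory Defs
  imports "HOL-Analysis.Analysis"
begin

section \<open>Simple graphs\<close>

record 'a ugraph =
  verts :: "'a set"
  edges :: "'a set set"

definition simple_graph :: "'a ugraph \<Rightarrow> bool" where
  "simple_graph G \<longleftrightarrow>
     finite (verts G) \<and> (\<forall>e\<in>edges G. e \<subseteq> verts G \<and> card e = 2)"

definition order :: "'a ugraph \<Rightarrow> nat" where
  "order G = card (verts G)"

definition subgraph :: "'a ugraph \<Rightarrow> 'a ugraph \<Rightarrow> bool" where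
  "subgraph H G \<longleftrightarrow>
     simple_graph H \<and> simple_graph G \<and> verts H \<subseteq> verts G \<and> edges H \<subseteq> edges G"

definition graph_connected :: "'a ugraph \<Rightarrow> bool" where
  "graph_connected G \<longleftrightarrow>
     verts G \<noteq> {} \<and>
     (\<forall>u\<in>verts G. \<forall>v\<in>verts G. (u, v) \<in> {(x, y). {x, y} \<in> edges G}\<^sup>*)"

definition delete_vertex :: "'a ugraph \<Rightarrow> 'a \<Rightarrow> 'a ugraph" where
  "delete_vertex G v =
     \<lparr>verts = verts G - {v}, edges = {e \<in> edges G. v \<notin> e}\<rparr>"

definition two_connected :: "'a ugraph \<Rightarrow> bool" where
  "two_connected G \<longleftrightarrow>
     card (verts G) > 2 \<and> graph_connected G \<and>
     (\<forall>v\<in>verts G. graph_connected (delete_vertex G v))"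

text \<open>
  With the convention that a 2-connected graph has more than two vertices, bridges and isolated
  vertices lie in no block. As a single edge or vertex can always be drawn, counting them as
  blocks would not change which graphs are pseudo-outerplanar.
\<close>

definition block :: "'a ugraph \<Rightarrow> 'a ugraph \<Rightarrow> bool" where
  "block B G \<longleftrightarrow>
     subgraph B G \<and> two_connected B \<and>
     (\<forall>H. subgraph H G \<and> two_connected H \<and> subgraph B H \<longrightarrow> H = B)"

definition cycle :: "'a ugraph \<Rightarrow> 'a list \<Rightarrow> bool" where
  "cycle G vs \<longleftrightarrow>
     length vs \<ge> 3 \<and> distinct vs \<and> set vs \<subseteq> verts G \<and>
     (\<forall>i<length vs. {vs ! i, vs ! (Suc i mod length vs)} \<in> edges G)"

definition forest :: "'a ugraph \<Rightarrow> bool" where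
  "forest G \<longleftrightarrow> simple_graph G \<and> (\<nexists>vs. cycle G vs)"

text \<open>The classes of the partition may be empty; they are viewed as spanning subgraphs.\<close>

definition partitions_into_two_forests :: "'a ugraph \<Rightarrow> bool" where
  "partitions_into_two_forests G \<longleftrightarrow>
     (\<exists>F1 F2. F1 \<union> F2 = edges G \<and> F1 \<inter> F2 = {} \<and>
        forest \<lparr>verts = verts G, edges = F1\<rparr> \<and>
        forest \<lparr>verts = verts G, edges = F2\<rparr>)"


section \<open>Drawings in a disk\<close>

text \<open>
  The plane is identified with the complex numbers. A vertex \<open>v\<close> is drawn as the point
  \<open>p v\<close> on the circle with centre \<open>c\<close> and radius \<open>r\<close>, and an edge \<open>e\<close> as a simple arc
  \<open>\<gamma> e\<close> joining its two ends and otherwise inside the open disk; in particular, an edge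
  passes through no vertex other than its ends. As usual for drawings, two distinct edges have
  only finitely many points in common.
\<close>

definition disk_drawing ::
  "'a ugraph \<Rightarrow> complex \<Rightarrow> real \<Rightarrow> ('a \<Rightarrow> complex) \<Rightarrow> ('a set \<Rightarrow> real \<Rightarrow> complex) \<Rightarrow> bool" where
  "disk_drawing G c r p \<gamma> \<longleftrightarrow>
     0 < r \<and> inj_on p (verts G) \<and> p ` verts G \<subseteq> sphere c r \<and>
     (\<forall>e\<in>edges G.
        arc (\<gamma> e) \<and> {pathstart (\<gamma> e), pathfinish (\<gamma> e)} = p ` e \<and>
        path_image (\<gamma> e) - p ` e \<subseteq> ball c r) \<and>
     (\<forall>e\<in>edges G. \<forall>f\<in>edges G. e \<noteq> f \<longrightarrow> finite (path_image (\<gamma> e) \<inter> path_image (\<gamma> f)))"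

text \<open>
  Two distinct edges cross if they meet in a point that is not the image of a common end.
  A mere touching counts as a crossing.
\<close>

definition crosses ::
  "('a \<Rightarrow> complex) \<Rightarrow> ('a set \<Rightarrow> real \<Rightarrow> complex) \<Rightarrow> 'a set \<Rightarrow> 'a set \<Rightarrow> bool" where
  "crosses p \<gamma> e f \<longleftrightarrow>
     e \<noteq> f \<and> \<not> path_image (\<gamma> e) \<inter> path_image (\<gamma> f) \<subseteq> p ` (e \<inter> f)"

definition pseudo_outerplanar_drawable :: "'a ugraph \<Rightarrow> bool" where
  "pseudo_outerplanar_drawable G \<longleftrightarrow>
     (\<exists>c r p \<gamma>. disk_drawing G c r p \<gamma> \<and>
        (\<forall>e\<in>edges G. card {f \<in> edges G. crosses p \<gamma> e f} \<le> 1))"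

definition pseudo_outerplanar :: "'a ugraph \<Rightarrow> bool" where
  "pseudo_outerplanar G \<longleftrightarrow>
     simple_graph G \<and> (\<forall>B. block B G \<longrightarrow> pseudo_outerplanar_drawable B)"

end

theory Submission
  imports Defs
begin

text \<open>
  A graph on six vertices that splits into two forests has at most \<open>2 \<cdot> 5 = 10\<close> edges. Gluing two
  copies of \<open>K\<^sub>4\<close>, on \<open>{0, 1, 2, 3}\<close> and \<open>{0, 3, 4, 5}\<close>, along the edge \<open>{0, 3}\<close> gives 11 edges
  on six vertices. Adding the missing edges of the Hamiltonian cycle \<open>0, 1, \<dots>, n - 1\<close> makes the graph
  2-connected. Placing the vertices on a circle in this order and drawing the edges as chords, the
  only crossings are \<open>{0, 2}\<close> with \<open>{1, 3}\<close> and \<open>{0, 4}\<close> with \<open>{3, 5}\<close>.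
\<close>

section \<open>Forests\<close>

lemma cycle_mono:
  assumes "cycle H vs" "verts H \<subseteq> verts G" "edges H \<subseteq> edges G"
  shows "cycle G vs"
  using assms unfolding cycle_def by blast

lemma forest_mono:
  assumes "forest G" "simple_graph H" "verts H \<subseteq> verts G" "edges H \<subseteq> edges G"
  shows "forest H"
  using assms cycle_mono unfolding forest_def by blast

lemma simple_graph_finite_edges:
  assumes "simple_graph G"
  shows "finite (edges G)"
  using assms finite_subset[of "edges G" "Pow (verts G)"] unfolding simple_graph_def by auto

lemma simple_graph_delete_vertex:
  assumes "simple_graph G"
  shows "simple_graph (delete_vertex G v)"
  using assms unfolding simple_graph_def delete_vertex_def by auto

text \<open>Consider a longest path. Its first vertex has a neighbour \<open>w\<close> other than
  its successor on the path; by maximality \<open>w\<close> lies on the path, so the stretch up to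
  \<open>w\<close> closes to a cycle.\<close>

lemma exists_cycle_if_min_degree_2:
  assumes G: "simple_graph G" and ne: "verts G \<noteq> {}"
    and deg: "\<And>v. v \<in> verts G \<Longrightarrow> 2 \<le> card {e \<in> edges G. v \<in> e}"
  shows "\<exists>vs. cycle G vs"
proof -
  define path where "path vs \<longleftrightarrow> vs \<noteq> [] \<and> distinct vs \<and> set vs \<subseteq> verts G \<and>
    successively (\<lambda>x y. {x, y} \<in> edges G) vs" for vs
  have fin: "finite (verts G)"
    using G by (simp add: simple_graph_def)
  obtain v where "v \<in> verts G"
    using ne by blast
  then have "path [v]"
    by (simp add: path_def)
  moreover have "length vs \<le> card (verts G)" if "path vs" for vs
    using that fin by (metis path_def card_mono distinct_card)
  \<comment> \<open>A path has at most as many vertices as \<open>G\<close>, so a longest one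
    exists; the bound is taken strictly, hence the \<open>Suc\<close>.\<close>
  ultimately obtain vs where vs: "path vs" and max: "\<And>ws. path ws \<Longrightarrow> length ws \<le> length vs"
    using ex_has_greatest_nat[of path "[v]" length "Suc (card (verts G))"] by (metis le_imp_less_Suc)
  define x where "x = hd vs"
  have vs_x: "vs = x # tl vs"
    using vs by (simp add: path_def x_def)
  have x: "x \<in> verts G"
    using vs vs_x by (metis path_def list.set_intros(1) subsetD)
  \<comment> \<open>If the path is the single vertex \<open>x\<close>, then \<open>vs ! 1\<close> is
    an unspecified value. This is harmless: at least two edges at \<open>x\<close> still leave one
    different from \<open>{x, vs ! 1}\<close>.\<close>
  have "\<not> {e \<in> edges G. x \<in> e} \<subseteq> {{x, vs ! 1}}"
    using deg[OF x] card_mono[of "{{x, vs ! 1}}" "{e \<in> edges G. x \<in> e}"] by auto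
  then obtain e where e: "e \<in> edges G" "x \<in> e" "e \<noteq> {x, vs ! 1}"
    by blast
  then obtain w where w: "e = {x, w}" "w \<noteq> x" "w \<noteq> vs ! 1"
    using G unfolding simple_graph_def card_2_iff by (metis doubleton_eq_iff insertE singletonD)
  have "w \<in> verts G"
    using e(1) w(1) G by (auto simp: simple_graph_def)
  have "w \<in> set vs"
  proof (rule ccontr)
    assume "w \<notin> set vs"
    moreover have "successively (\<lambda>x y. {x, y} \<in> edges G) (w # x # tl vs)"
      unfolding successively.simps(3) unfolding vs_x[symmetric]
      using vs e(1) w(1) by (simp add: path_def insert_commute)
    ultimately have "path (w # vs)"
      using vs \<open>w \<in> verts G\<close> unfolding vs_x[symmetric] by (simp add: path_def)
    from max[OF this] show False
      by simp
  qed
  then obtain j where j: "j < length vs" "vs ! j = w"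
    by (meson in_set_conv_nth)
  have "vs ! 0 = x"
    by (subst vs_x) simp
  then have "j \<noteq> 0" "j \<noteq> 1"
    using j(2) w(2,3) by metis+
  then have "2 \<le> j"
    by simp
  have adj: "{vs ! i, vs ! Suc i} \<in> edges G" if "Suc i < length vs" for i
    using vs that by (auto simp: path_def successively_conv_nth)
  \<comment> \<open>By \<open>2 \<le> j\<close> the prefix ending in \<open>w\<close> has at least
    three vertices, and the edge \<open>e\<close> leads from \<open>w\<close> back to
    \<open>x\<close>.\<close>
  have "cycle G (take (Suc j) vs)"
    unfolding cycle_def
  proof (intro conjI allI impI)
    show "3 \<le> length (take (Suc j) vs)"
      using j \<open>2 \<le> j\<close> by simp
    show "distinct (take (Suc j) vs)"
      using vs by (simp add: path_def)
    show "set (take (Suc j) vs) \<subseteq> verts G"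
      using vs set_take_subset[of "Suc j" vs] by (auto simp: path_def)
    fix i assume "i < length (take (Suc j) vs)"
    then have "i \<le> j"
      by simp
    show "{take (Suc j) vs ! i, take (Suc j) vs ! (Suc i mod length (take (Suc j) vs))} \<in> edges G"
    proof (cases "i = j")
      case True
      then show ?thesis
        using j e(1) w(1) \<open>vs ! 0 = x\<close> by (simp add: insert_commute)
    next
      case False
      then show ?thesis
        using j \<open>i \<le> j\<close> adj[of i] by simp
    qed
  qed
  then show ?thesis
    by blast
qed

text \<open>If some vertex has degree at most 1, deleting it costs one vertex and at most one edge,
  so the inequality survives and induction applies. Otherwise all degrees are at least 2.\<close>

lemma exists_cycle_if_many_edges:
  assumes "simple_graph G" "verts G \<noteq> {}" "card (verts G) \<le> card (edges G)"
  shows "\<exists>vs. cycle G vs"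
  using assms
proof (induction "card (verts G)" arbitrary: G rule: less_induct)
  case less
  show ?case
  proof (cases "\<forall>v\<in>verts G. 2 \<le> card {e \<in> edges G. v \<in> e}")
    case True
    then show ?thesis
      using exists_cycle_if_min_degree_2[OF less.prems(1,2)] by blast
  next
    case False
    then obtain v where v: "v \<in> verts G" "card {e \<in> edges G. v \<in> e} \<le> 1"
      by force
    let ?H = "delete_vertex G v"
    have fin: "finite (verts G)" "finite (edges G)"
      using less.prems(1) simple_graph_finite_edges by (auto simp: simple_graph_def)
    have cardV: "card (verts G) = Suc (card (verts ?H))"
      using v(1) fin card.remove[of "verts G" v] by (simp add: delete_vertex_def)
    have "edges G = edges ?H \<union> {e \<in> edges G. v \<in> e}"
      by (auto simp: delete_vertex_def)
    then have "card (edges G) \<le> card (edges ?H) + card {e \<in> edges G. v \<in> e}"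
      by (metis card_Un_le)
    then have cardE: "card (verts ?H) \<le> card (edges ?H)"
      using v(2) cardV less.prems(3) by linarith
    \<comment> \<open>If \<open>v\<close> were the only vertex, the inequality would demand an edge
      within \<open>{v}\<close>.\<close>
    have "verts ?H \<noteq> {}"
    proof
      assume "verts ?H = {}"
      then have "verts G = {v}"
        using v(1) by (auto simp: delete_vertex_def)
      moreover have "edges G \<noteq> {}"
        using less.prems(3) cardV by auto
      ultimately obtain e where "e \<subseteq> {v}" "card e = 2"
        using less.prems(1) by (auto simp: simple_graph_def)
      then show False
        using card_mono[of "{v}" e] by simp
    qed
    then obtain vs where "cycle ?H vs"
      using less.hyps[of ?H] cardV cardE simple_graph_delete_vertex[OF less.prems(1)] by auto
    then have "cycle G vs"
      by (rule cycle_mono) (auto simp: delete_vertex_def)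
    then show ?thesis
      by blast
  qed
qed

lemma forest_card_edges:
  assumes "forest G" "verts G \<noteq> {}"
  shows "card (edges G) < card (verts G)"
  using assms exists_cycle_if_many_edges[of G] unfolding forest_def by force

text \<open>A dense spot is enough: each of the two forests meets \<open>H\<close> in a forest on
  \<open>verts H\<close>, which has at most \<open>card (verts H) - 1\<close> edges, and together
  they would have to cover \<open>edges H\<close>.\<close>

lemma not_partitions_into_two_forests:
  assumes H: "subgraph H G" "verts H \<noteq> {}"
    and many: "2 * (card (verts H) - 1) < card (edges H)"
  shows "\<not> partitions_into_two_forests G"
proof
  assume "partitions_into_two_forests G"
  then obtain F1 F2 where F: "F1 \<union> F2 = edges G"
    "forest \<lparr>verts = verts G, edges = F1\<rparr>" "forest \<lparr>verts = verts G, edges = F2\<rparr>"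
    unfolding partitions_into_two_forests_def by blast
  have bound: "card (edges H \<inter> F) \<le> card (verts H) - 1"
    if "forest \<lparr>verts = verts G, edges = F\<rparr>" for F
  proof -
    have "forest \<lparr>verts = verts H, edges = edges H \<inter> F\<rparr>"
      using H(1) by (intro forest_mono[OF that]) (auto simp: subgraph_def simple_graph_def)
    from forest_card_edges[OF this] show ?thesis
      using H(2) by simp
  qed
  have "edges H = (edges H \<inter> F1) \<union> (edges H \<inter> F2)"
    using F(1) H(1) by (auto simp: subgraph_def)
  then have "card (edges H) \<le> card (edges H \<inter> F1) + card (edges H \<inter> F2)"
    by (metis card_Un_le)
  then show False
    using bound[OF F(2)] bound[OF F(3)] many by linarith
qed

section \<open>Hamiltonian graphs\<close>

text \<open>Steps to the successor lead upwards, and symmetry gives the way back. This serves for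
  the stretches into which a deleted vertex cuts the Hamiltonian path.\<close>

lemma rtrancl_interval:
  fixes a b :: nat
  assumes "sym R" and step: "\<And>i. a \<le> i \<Longrightarrow> i < b \<Longrightarrow> (i, Suc i) \<in> R"
    and "i \<in> {a..b}" "j \<in> {a..b}"
  shows "(i, j) \<in> R\<^sup>*"
proof -
  have up: "(i, j) \<in> R\<^sup>*" if "i \<le> j" "a \<le> i" "j \<le> b" for i j
    using that
  proof (induction j rule: dec_induct)
    case (step m)
    then show ?case
      using assms(2)[of m] by (meson Suc_le_lessD le_trans less_imp_le rtrancl.rtrancl_into_rtrancl)
  qed simp
  show ?thesis
    using up[of i j] up[of j i] assms(3,4) sym_rtrancl[OF assms(1)]
    by (metis atLeastAtMost_iff nat_le_linear symD)
qed

text \<open>Deleting \<open>v\<close> leaves the stretches below and above \<open>v\<close>. If both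
  are nonempty, they contain 0 and \<open>n - 1\<close> respectively, and the closing edge joins
  them.\<close>

lemma two_connected_if_hamiltonian:
  assumes V: "verts G = {..<n}" and n: "3 \<le> n"
    and path: "\<And>i. Suc i < n \<Longrightarrow> {i, Suc i} \<in> edges G" and closing: "{0, n - 1} \<in> edges G"
  shows "two_connected G"
proof -
  have "graph_connected G"
  proof -
    have "(u, v) \<in> {(x, y). {x, y} \<in> edges G}\<^sup>*" if "u < n" "v < n" for u v
      by (rule rtrancl_interval[of _ 0 "n - 1"])
        (use that path in \<open>auto simp: sym_def insert_commute\<close>)
    then show ?thesis
      using V n by (auto simp: graph_connected_def lessThan_empty_iff)
  qed
  moreover have "graph_connected (delete_vertex G v)" if "v < n" for v
  proof -
    define R where "R = {(x, y). {x, y} \<in> edges (delete_vertex G v)}"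
    have R: "(x, y) \<in> R \<longleftrightarrow> {x, y} \<in> edges G \<and> x \<noteq> v \<and> y \<noteq> v" for x y
      by (auto simp: R_def delete_vertex_def)
    have sym: "sym R"
      by (auto simp: sym_def R insert_commute)
    \<comment> \<open>For \<open>v = 0\<close> the bound \<open>v - 1\<close> truncates to 0, but
      then there is no \<open>i < v\<close>.\<close>
    have low: "(i, j) \<in> R\<^sup>*" if "i < v" "j < v" for i j
      by (rule rtrancl_interval[OF sym, of 0 "v - 1"])
        (use that \<open>v < n\<close> in \<open>auto simp: R intro!: path\<close>)
    have high: "(i, j) \<in> R\<^sup>*" if "v < i" "i < n" "v < j" "j < n" for i j
      by (rule rtrancl_interval[OF sym, of "Suc v" "n - 1"])
        (use that in \<open>auto simp: R intro!: path\<close>)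
    have cross: "(i, j) \<in> R\<^sup>*" if "i < v" "v < j" "j < n" for i j
    proof -
      have "(i, 0) \<in> R\<^sup>*"
        using low that by simp
      also have "(0, n - 1) \<in> R"
        using closing that by (auto simp: R)
      also have "(n - 1, j) \<in> R\<^sup>*"
        using high that by simp
      finally show ?thesis .
    qed
    have "(i, j) \<in> R\<^sup>*" if "i < n" "j < n" "i \<noteq> v" "j \<noteq> v" for i j
      using that low[of i j] high[of i j] cross[of i j] cross[of j i] sym_rtrancl[OF sym]
      by (metis linorder_neqE_nat symD)
    moreover have "verts (delete_vertex G v) \<noteq> {}"
    proof -
      have "(if v = 0 then 1 else 0) \<in> verts (delete_vertex G v)"
        using n V by (simp add: delete_vertex_def)
      then show ?thesis
        by blast
    qed
    moreover have "verts (delete_vertex G v) = {..<n} - {v}"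
      by (simp add: delete_vertex_def V)
    ultimately show ?thesis
      unfolding graph_connected_def R_def[symmetric] by simp
  qed
  ultimately show ?thesis
    using V n by (simp add: two_connected_def)
qed

section \<open>Chords of the unit circle\<close>

text \<open>The rational parametrisation of the circle, with increasing angle.\<close>

definition circle_point :: "nat \<Rightarrow> complex" where
  "circle_point k =
     Complex ((1 - (real k)\<^sup>2) / (1 + (real k)\<^sup>2)) (2 * real k / (1 + (real k)\<^sup>2))"

text \<open>Twice the signed area of the triangle with corners \<open>circle_point a\<close>,
  \<open>circle_point b\<close> and \<open>z\<close>. Its sign tells on which side of the line
  through the first two the point \<open>z\<close> lies.\<close>

definition side :: "nat \<Rightarrow> nat \<Rightarrow> complex \<Rightarrow> real" where
  "side a b z = Im (cnj (circle_point b - circle_point a) * (z - circle_point a))"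

definition interleaved :: "nat \<Rightarrow> nat \<Rightarrow> nat \<Rightarrow> nat \<Rightarrow> bool" where
  "interleaved a b c d \<longleftrightarrow> a < c \<and> c < b \<and> b < d \<or> c < a \<and> a < d \<and> d < b"

lemma norm_circle_point: "norm (circle_point k) = 1"
proof -
  have pos: "1 + (real k)\<^sup>2 \<noteq> 0"
    by (smt (verit) zero_le_power2)
  have "(1 - (real k)\<^sup>2)\<^sup>2 + (2 * real k)\<^sup>2 = (1 + (real k)\<^sup>2)\<^sup>2"
    by algebra
  then have "((1 - (real k)\<^sup>2) / (1 + (real k)\<^sup>2))\<^sup>2 + (2 * real k / (1 + (real k)\<^sup>2))\<^sup>2 = 1"
    using pos by (simp only: power_divide flip: add_divide_distrib) simp
  then show ?thesis
    by (simp add: circle_point_def cmod_def)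
qed

text \<open>The area is a 3 by 3 determinant. Clearing denominators gives rows
  \<open>(1 + x^2, 1 - x^2, 2 * x)\<close> for \<open>x = a, b, k\<close>; this is a Vandermonde
  matrix times a constant matrix of determinant 4.\<close>

lemma side_circle_point:
  "side a b (circle_point k) =
     4 * (real b - real a) * (real k - real a) * (real k - real b) /
     ((1 + (real a)\<^sup>2) * (1 + (real b)\<^sup>2) * (1 + (real k)\<^sup>2))"
proof -
  have pos: "1 + x\<^sup>2 \<noteq> 0" for x :: real
    by (smt (verit) zero_le_power2)
  show ?thesis
    using pos[of "real a"] pos[of "real b"] pos[of "real k"]
    by (simp add: side_def circle_point_def divide_simps) algebra
qed

lemma side_circle_point_eq_0_iff:
  assumes "a < b"
  shows "side a b (circle_point k) = 0 \<longleftrightarrow> k \<in> {a, b}"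
proof -
  have pos: "1 + x\<^sup>2 \<noteq> 0" for x :: real
    by (smt (verit) zero_le_power2)
  show ?thesis
    using assms pos by (auto simp: side_circle_point)
qed

text \<open>For \<open>a < b\<close> the sign of \<open>side\<close> at the parameter
  \<open>x\<close> is that of \<open>q x\<close>. Without interleaving, \<open>c\<close> and
  \<open>d\<close> both lie in the closed interval from \<open>a\<close> to \<open>b\<close> or both
  lie outside its interior, so \<open>q\<close> has the same weak sign at both.\<close>

lemma side_mult_nonneg:
  assumes "a < b" "c < d" "\<not> interleaved a b c d"
  shows "0 \<le> side a b (circle_point c) * side a b (circle_point d)"
proof -
  define q where "q x = (real x - real a) * (real x - real b)" for x
  have out: "0 \<le> q x" if "x \<le> a \<or> b \<le> x" for x
    using that assms(1) unfolding q_def by (auto intro: mult_nonpos_nonpos)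
  have inn: "q x \<le> 0" if "a \<le> x" "x \<le> b" for x
    using that unfolding q_def by (auto intro: mult_nonneg_nonpos)
  have "(c \<le> a \<or> b \<le> c) \<and> (d \<le> a \<or> b \<le> d) \<or> (a \<le> c \<and> c \<le> b) \<and> (a \<le> d \<and> d \<le> b)"
    using assms unfolding interleaved_def by linarith
  then have "0 \<le> q c * q d"
    using out inn by (auto intro: mult_nonneg_nonneg mult_nonpos_nonpos)
  moreover have "\<exists>r\<ge>0. side a b (circle_point x) = r * q x" for x
    using assms(1)
    by (intro exI[of _ "4 * (real b - real a) / ((1 + (real a)\<^sup>2) * (1 + (real b)\<^sup>2) * (1 + (real x)\<^sup>2))"])
      (auto simp: side_circle_point q_def)
  then obtain r s where "0 \<le> r" "side a b (circle_point c) = r * q c"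
    "0 \<le> s" "side a b (circle_point d) = s * q d"
    by metis
  ultimately show ?thesis
    by (metis mult.commute mult.left_commute mult_nonneg_nonneg)
qed

text \<open>If the points of \<open>a < b\<close> coincided, \<open>side a b\<close> would vanish
  everywhere, yet it is nonzero at the third parameter \<open>Suc b\<close>.\<close>

lemma inj_circle_point: "inj circle_point"
proof (rule injI)
  fix a b :: nat
  have aux: "circle_point a \<noteq> circle_point b" if "a < b" for a b
  proof
    assume eq: "circle_point a = circle_point b"
    have "side a b (circle_point (Suc b)) = 0"
      by (simp add: side_def eq)
    then show False
      using side_circle_point_eq_0_iff[OF that, of "Suc b"] that by simp
  qed
  assume "circle_point a = circle_point b"
  then show "a = b"
    using aux[of a b] aux[of b a] by (metis linorder_neqE_nat)
qed

section \<open>Intersections of two chords\<close>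

lemma side_combination:
  "side a b ((1 - t) *\<^sub>R x + t *\<^sub>R y) = (1 - t) * side a b x + t * side a b y"
  by (simp add: side_def algebra_simps)

lemma side_closed_segment:
  assumes "z \<in> closed_segment (circle_point a) (circle_point b)"
  shows "side a b z = 0"
proof -
  have "side a b (circle_point a) = 0" "side a b (circle_point b) = 0"
    by (simp_all add: side_circle_point)
  then show ?thesis
    using assms by (auto simp: closed_segment_def side_combination)
qed

text \<open>Since \<open>side a b\<close> is affine and vanishes on the first chord, the position
  \<open>t\<close> of a common point on the second chord satisfies a linear equation. It is
  nontrivial: if both coefficients vanished, \<open>c\<close> and \<open>d\<close> would be
  \<open>a\<close> and \<open>b\<close>.\<close>

lemma chord_inter_cases:
  assumes "a < b" "c < d" "(a, b) \<noteq> (c, d)"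
    and "z \<in> closed_segment (circle_point a) (circle_point b)"
    and "z \<in> closed_segment (circle_point c) (circle_point d)"
  obtains t where "0 \<le> t" "t \<le> 1" "z = (1 - t) *\<^sub>R circle_point c + t *\<^sub>R circle_point d"
    "(1 - t) * side a b (circle_point c) + t * side a b (circle_point d) = 0"
    "side a b (circle_point c) \<noteq> 0 \<or> side a b (circle_point d) \<noteq> 0"
proof -
  obtain t where t: "0 \<le> t" "t \<le> 1" "z = (1 - t) *\<^sub>R circle_point c + t *\<^sub>R circle_point d"
    using assms(5) by (auto simp: closed_segment_def)
  moreover have "(1 - t) * side a b (circle_point c) + t * side a b (circle_point d) = 0"
    using side_closed_segment[OF assms(4)] t(3) by (simp add: side_combination)
  moreover have "side a b (circle_point c) \<noteq> 0 \<or> side a b (circle_point d) \<noteq> 0"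
    using assms(1-3) side_circle_point_eq_0_iff[OF assms(1)] by auto
  ultimately show ?thesis
    using that by blast
qed

lemma finite_chord_inter:
  assumes "a < b" "c < d" "(a, b) \<noteq> (c, d)"
  shows "finite (closed_segment (circle_point a) (circle_point b) \<inter>
                 closed_segment (circle_point c) (circle_point d))"
proof -
  define C D where "C = side a b (circle_point c)" and "D = side a b (circle_point d)"
  \<comment> \<open>The linear equation \<open>(1 - t) * C + t * D = 0\<close> has the only solution
    \<open>t = C / (C - D)\<close>, so the chords share at most one point.\<close>
  have "closed_segment (circle_point a) (circle_point b) \<inter>
      closed_segment (circle_point c) (circle_point d) \<subseteq>
      {(1 - C / (C - D)) *\<^sub>R circle_point c + (C / (C - D)) *\<^sub>R circle_point d}"
  proof
    fix z assume z: "z \<in> closed_segment (circle_point a) (circle_point b) \<inter>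
        closed_segment (circle_point c) (circle_point d)"
    then obtain t where t: "z = (1 - t) *\<^sub>R circle_point c + t *\<^sub>R circle_point d"
      "(1 - t) * C + t * D = 0" "C \<noteq> 0 \<or> D \<noteq> 0"
      using chord_inter_cases[OF assms, of z] unfolding C_def D_def by blast
    have eq: "t * (C - D) = C"
      using t(2) by (simp add: algebra_simps)
    then have "C - D \<noteq> 0"
      using t(3) by auto
    then have "t = C / (C - D)"
      using eq by (simp add: field_simps)
    then show "z \<in> {(1 - C / (C - D)) *\<^sub>R circle_point c + (C / (C - D)) *\<^sub>R circle_point d}"
      using t(1) by simp
  qed
  then show ?thesis
    using finite_subset by blast
qed

text \<open>The ends of the second chord lie weakly on one side of the first, so both terms of the
  linear equation have the same weak sign and must vanish. This forces \<open>t\<close> to be 0 or 1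
  and the corresponding end to be \<open>a\<close> or \<open>b\<close>.\<close>

lemma chord_inter_not_interleaved:
  assumes "a < b" "c < d" "(a, b) \<noteq> (c, d)" "\<not> interleaved a b c d"
  shows "closed_segment (circle_point a) (circle_point b) \<inter>
         closed_segment (circle_point c) (circle_point d) \<subseteq> circle_point ` ({a, b} \<inter> {c, d})"
proof
  fix z assume z: "z \<in> closed_segment (circle_point a) (circle_point b) \<inter>
      closed_segment (circle_point c) (circle_point d)"
  let ?C = "side a b (circle_point c)" and ?D = "side a b (circle_point d)"
  obtain t where t: "0 \<le> t" "t \<le> 1" "z = (1 - t) *\<^sub>R circle_point c + t *\<^sub>R circle_point d"
    "(1 - t) * ?C + t * ?D = 0" "?C \<noteq> 0 \<or> ?D \<noteq> 0"
    using chord_inter_cases[OF assms(1-3), of z] z by blast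
  have "0 \<le> ?C * ?D"
    using side_mult_nonneg assms by blast
  then have "0 \<le> ?C \<and> 0 \<le> ?D \<or> ?C \<le> 0 \<and> ?D \<le> 0"
    by (simp add: zero_le_mult_iff)
  then have "(1 - t) * ?C = 0 \<and> t * ?D = 0"
  proof
    assume "0 \<le> ?C \<and> 0 \<le> ?D"
    then have "0 \<le> (1 - t) * ?C" "0 \<le> t * ?D"
      using t(1,2) by auto
    then show ?thesis
      using t(4) by linarith
  next
    assume "?C \<le> 0 \<and> ?D \<le> 0"
    then have "(1 - t) * ?C \<le> 0" "t * ?D \<le> 0"
      using t(1,2) by (auto intro: mult_nonneg_nonpos)
    then show ?thesis
      using t(4) by linarith
  qed
  then consider "t = 1" "?D = 0" | "t = 0" "?C = 0"
    using t(5) by fastforce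
  then show "z \<in> circle_point ` ({a, b} \<inter> {c, d})"
    using t(3) side_circle_point_eq_0_iff[OF assms(1)] by cases auto
qed

lemma chord_inside_disk:
  "closed_segment (circle_point a) (circle_point b) - circle_point ` {a, b} \<subseteq> ball 0 1"
proof
  fix z assume "z \<in> closed_segment (circle_point a) (circle_point b) - circle_point ` {a, b}"
  then have "z \<in> open_segment (circle_point a) (circle_point b)"
    by (auto simp: open_segment_def)
  from dist_decreases_open_segment[OF this, of 0] show "z \<in> ball 0 1"
    by (auto simp: norm_circle_point)
qed

section \<open>Straight-line drawings of graphs on the natural numbers\<close>

text \<open>An edge is an unordered set; \<open>Min\<close> and \<open>Max\<close> recover its two
  ends and fix a direction for the path.\<close>

definition chord :: "nat set \<Rightarrow> real \<Rightarrow> complex" where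
  "chord e = linepath (circle_point (Min e)) (circle_point (Max e))"

lemma path_image_chord:
  "a < b \<Longrightarrow> path_image (chord {a, b}) = closed_segment (circle_point a) (circle_point b)"
  by (simp add: chord_def max_def min_def)

lemma simple_graph_edgeE:
  fixes G :: "'a::linorder ugraph"
  assumes "simple_graph G" "e \<in> edges G"
  obtains a b where "e = {a, b}" "a < b"
proof -
  have "card e = 2"
    using assms by (simp add: simple_graph_def)
  then obtain a b where "e = {a, b}" "a \<noteq> b"
    by (auto simp: card_2_iff)
  then show ?thesis
    using that[of a b] that[of b a] by (metis insert_commute linorder_neqE)
qed

lemma chord_crosses_imp_interleaved:
  assumes "crosses circle_point chord {a, b} {c, d}" "a < b" "c < d"
  shows "interleaved a b c d"
proof (rule ccontr)
  assume "\<not> interleaved a b c d"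
  moreover have "(a, b) \<noteq> (c, d)"
    using assms(1) by (auto simp: crosses_def)
  ultimately show False
    using chord_inter_not_interleaved[of a b c d] assms
    by (simp add: crosses_def path_image_chord)
qed

lemma disk_drawing_chords:
  assumes "simple_graph G"
  shows "disk_drawing G 0 1 circle_point chord"
  unfolding disk_drawing_def
proof (intro conjI ballI impI)
  show "inj_on circle_point (verts G)"
    using inj_circle_point inj_on_subset by blast
  show "circle_point ` verts G \<subseteq> sphere 0 1"
    by (auto simp: norm_circle_point)
next
  fix e assume "e \<in> edges G"
  then obtain a b where e: "e = {a, b}" "a < b"
    using simple_graph_edgeE[OF assms] by blast
  then have "circle_point a \<noteq> circle_point b"
    using inj_circle_point by (auto dest: injD)
  then show "arc (chord e)" "{pathstart (chord e), pathfinish (chord e)} = circle_point ` e"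
    using e by (auto simp: chord_def max_def min_def)
  show "path_image (chord e) - circle_point ` e \<subseteq> ball 0 1"
    using chord_inside_disk[of a b] e by (simp add: path_image_chord)
next
  fix e f assume "e \<in> edges G" "f \<in> edges G" "e \<noteq> f"
  then obtain a b c d where ef: "e = {a, b}" "a < b" "f = {c, d}" "c < d"
    by (metis simple_graph_edgeE[OF assms])
  then show "finite (path_image (chord e) \<inter> path_image (chord f))"
    using finite_chord_inter[of a b c d] \<open>e \<noteq> f\<close> by (auto simp: path_image_chord)
qed simp

text \<open>Restricting a drawing creates no new crossings. As blocks are subgraphs, a single
  drawing of the whole graph thus settles all of its blocks.\<close>

lemma pseudo_outerplanar_drawable_subgraph:
  assumes "subgraph B G" "pseudo_outerplanar_drawable G"
  shows "pseudo_outerplanar_drawable B"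
proof -
  obtain c r p \<gamma> where dr: "disk_drawing G c r p \<gamma>"
    and cr: "\<And>e. e \<in> edges G \<Longrightarrow> card {f \<in> edges G. crosses p \<gamma> e f} \<le> 1"
    using assms(2) unfolding pseudo_outerplanar_drawable_def by blast
  have sub: "verts B \<subseteq> verts G" "edges B \<subseteq> edges G" "simple_graph G"
    using assms(1) by (auto simp: subgraph_def)
  have "disk_drawing B c r p \<gamma>"
    using dr sub(1,2) inj_on_subset[of p "verts G" "verts B"] unfolding disk_drawing_def
    by (auto simp: subset_iff image_subset_iff)
  moreover have "card {f \<in> edges B. crosses p \<gamma> e f} \<le> 1" if "e \<in> edges B" for e
  proof -
    have "card {f \<in> edges B. crosses p \<gamma> e f} \<le> card {f \<in> edges G. crosses p \<gamma> e f}"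
      using sub simple_graph_finite_edges[OF sub(3)] by (intro card_mono) auto
    then show ?thesis
      using cr[of e] that sub(2) by force
  qed
  ultimately show ?thesis
    unfolding pseudo_outerplanar_drawable_def by blast
qed

section \<open>Two glued copies of the complete graph on four vertices\<close>

text \<open>The copies of \<open>K\<^sub>4\<close> take the five path edges from
  \<open>{0, 1}\<close> to \<open>{4, 5}\<close> and the six listed edges after
  \<open>{0, n - 1}\<close>. For \<open>n = 6\<close> the closing edge of the Hamiltonian cycle
  coincides with \<open>{0, 5}\<close>; for larger \<open>n\<close> the two differ.\<close>

definition glued_K4 :: "nat \<Rightarrow> nat ugraph" where
  "glued_K4 n = \<lparr>verts = {..<n}, edges = {{i, Suc i} | i. Suc i < n} \<union>
     {{0, n - 1}, {0, 2}, {1, 3}, {0, 3}, {0, 4}, {3, 5}, {0, 5}}\<rparr>"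

lemma glued_K4_verts: "verts (glued_K4 n) = {..<n}"
  by (simp add: glued_K4_def)

lemma simple_graph_glued_K4:
  assumes "6 \<le> n"
  shows "simple_graph (glued_K4 n)"
  using assms by (auto simp: simple_graph_def glued_K4_def)

lemma glued_K4_path_edge:
  assumes "Suc i < n"
  shows "{i, Suc i} \<in> edges (glued_K4 n)"
proof -
  have "{i, Suc i} \<in> {{i, Suc i} | i. Suc i < n}"
    using assms by blast
  then show ?thesis
    by (simp only: glued_K4_def ugraph.simps Un_iff simp_thms)
qed

lemma glued_K4_chord_edges:
  "e \<in> {{0, n - 1}, {0, 2}, {1, 3}, {0, 3}, {0, 4}, {3, 5}, {0, 5}} \<Longrightarrow> e \<in> edges (glued_K4 n)"
  by (simp only: glued_K4_def ugraph.simps Un_iff simp_thms)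

lemma two_connected_glued_K4:
  assumes "6 \<le> n"
  shows "two_connected (glued_K4 n)"
proof (rule two_connected_if_hamiltonian)
  show "verts (glued_K4 n) = {..<n}"
    by (rule glued_K4_verts)
  show "3 \<le> n"
    using assms by simp
qed (simp_all only: glued_K4_path_edge glued_K4_chord_edges insert_iff simp_thms)

lemma glued_K4_edge_cases:
  assumes "{a, b} \<in> edges (glued_K4 n)" "a < b" "6 \<le> n"
  shows "b = Suc a \<or> a = 0 \<and> b = n - 1 \<or>
    (a, b) \<in> {(0, 2), (1, 3), (0, 3), (0, 4), (3, 5), (0, 5)}"
proof -
  have "(\<exists>i. e = {i, Suc i}) \<or> e \<in> {{0, n - 1}, {0, 2}, {1, 3}, {0, 3}, {0, 4}, {3, 5}, {0, 5}}"
    if "e \<in> edges (glued_K4 n)" for e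
    using that unfolding glued_K4_def ugraph.simps Un_iff mem_Collect_eq
    by (elim disjE exE conjE) (rule disjI1, rule exI, assumption | rule disjI2, assumption)+
  from this[OF assms(1)] show ?thesis
    unfolding insert_iff empty_iff doubleton_eq_iff
    by (elim disjE exE conjE) (use assms(2,3) in simp_all)
qed

text \<open>An edge of the Hamiltonian cycle interleaves with nothing: no vertex lies strictly
  between \<open>a\<close> and \<open>Suc a\<close>, and none lies outside the range from 0 to
  \<open>n - 1\<close>. This leaves six chords to compare.\<close>

lemma glued_K4_interleaved:
  assumes "{a, b} \<in> edges (glued_K4 n)" "{c, d} \<in> edges (glued_K4 n)" "a < b" "c < d" "6 \<le> n"
    and "interleaved a b c d"
  shows "((a, b), (c, d)) \<in> {((0, 2), (1, 3)), ((1, 3), (0, 2)), ((0, 4), (3, 5)), ((3, 5), (0, 4))}"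
proof -
  have "b < n" "d < n"
    using assms(1,2) simple_graph_glued_K4[OF assms(5)] unfolding simple_graph_def
    by (simp_all add: glued_K4_verts) (meson insert_subset lessThan_iff)+
  then have "b \<noteq> Suc a" "d \<noteq> Suc c" "\<not> (a = 0 \<and> b = n - 1)" "\<not> (c = 0 \<and> d = n - 1)"
    using assms(6) unfolding interleaved_def by linarith+
  then have "(a, b) \<in> {(0, 2), (1, 3), (0, 3), (0, 4), (3, 5), (0, 5)}"
    "(c, d) \<in> {(0, 2), (1, 3), (0, 3), (0, 4), (3, 5), (0, 5)}"
    using glued_K4_edge_cases[OF assms(1,3,5)] glued_K4_edge_cases[OF assms(2,4,5)] by meson+
  then show ?thesis
    using assms(6) unfolding interleaved_def insert_iff empty_iff prod.inject
    by (elim disjE conjE) simp_all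
qed

text \<open>The four interleaved pairs have distinct first components, so an edge determines the
  only edge that it can cross.\<close>

lemma pseudo_outerplanar_drawable_glued_K4:
  assumes "6 \<le> n"
  shows "pseudo_outerplanar_drawable (glued_K4 n)"
  unfolding pseudo_outerplanar_drawable_def
proof (intro exI conjI ballI)
  have G: "simple_graph (glued_K4 n)"
    using assms by (rule simple_graph_glued_K4)
  then show "disk_drawing (glued_K4 n) 0 1 circle_point chord"
    by (rule disk_drawing_chords)
  fix e assume e: "e \<in> edges (glued_K4 n)"
  then obtain a b where ab: "e = {a, b}" "a < b"
    using simple_graph_edgeE[OF G] by blast
  have "f = g" if f: "f \<in> edges (glued_K4 n)" "crosses circle_point chord e f"
    and g: "g \<in> edges (glued_K4 n)" "crosses circle_point chord e g" for f g
  proof -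
    have *: "((a, b), (c, d)) \<in> {((0, 2), (1, 3)), ((1, 3), (0, 2)), ((0, 4), (3, 5)), ((3, 5), (0, 4))}"
      if "{c, d} \<in> edges (glued_K4 n)" "c < d" "crosses circle_point chord e {c, d}" for c d
      using glued_K4_interleaved[of a b n c d] chord_crosses_imp_interleaved[of a b c d]
        that e ab assms by blast
    obtain c d c' d' where "f = {c, d}" "c < d" "g = {c', d'}" "c' < d'"
      using f(1) g(1) by (metis simple_graph_edgeE[OF G])
    then show ?thesis
      using *[of c d] *[of c' d'] f g by auto
  qed
  then show "card {f \<in> edges (glued_K4 n). crosses circle_point chord e f} \<le> 1"
    by (simp add: card_le_Suc0_iff_eq simple_graph_finite_edges[OF G])
qed

lemma not_partitions_glued_K4:
  assumes "6 \<le> n"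
  shows "\<not> partitions_into_two_forests (glued_K4 n)"
proof -
  \<comment> \<open>The eleven edges of the two copies of \<open>K\<^sub>4\<close>, one more than
    the \<open>2 * (6 - 1)\<close> that two forests on six vertices can hold.\<close>
  define E :: "nat set set" where
    "E = {{0, 1}, {1, 2}, {2, 3}, {3, 4}, {4, 5}, {0, 2}, {1, 3}, {0, 3}, {0, 4}, {3, 5}, {0, 5}}"
  define H where "H = \<lparr>verts = {..<6 :: nat}, edges = E\<rparr>"
  have path: "{i, Suc i} \<in> edges (glued_K4 n)" if "i < 5" for i
  proof -
    have "Suc i < n"
      using that assms by simp
    then show ?thesis
      by (rule glued_K4_path_edge)
  qed
  have "{0, 1} \<in> edges (glued_K4 n)" "{1, 2} \<in> edges (glued_K4 n)"
    "{2, 3} \<in> edges (glued_K4 n)" "{3, 4} \<in> edges (glued_K4 n)" "{4, 5} \<in> edges (glued_K4 n)"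
    using path[of 0] path[of 1] path[of 2] path[of 3] path[of 4] by (simp_all add: numeral_eq_Suc)
  moreover have "{{0, 2}, {1, 3}, {0, 3}, {0, 4}, {3, 5}, {0, 5}} \<subseteq> edges (glued_K4 n)"
    by (simp only: glued_K4_chord_edges insert_iff insert_subset empty_subsetI simp_thms)
  ultimately have "E \<subseteq> edges (glued_K4 n)"
    by (simp add: E_def)
  moreover have "simple_graph H"
    by (simp add: simple_graph_def H_def E_def)
  ultimately have "subgraph H (glued_K4 n)"
    using assms simple_graph_glued_K4[OF assms] by (simp add: subgraph_def glued_K4_verts H_def)
  moreover have "card E = 11"
    by (simp add: E_def doubleton_eq_iff)
  ultimately show ?thesis
    by (intro not_partitions_into_two_forests[of H]) (simp_all add: H_def lessThan_empty_iff)
qed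

theorem theorem3p7:
  fixes n :: nat
  assumes "n \<ge> 6"
  shows "\<exists>G :: nat ugraph.
    simple_graph G \<and> order G = n \<and> two_connected G \<and> pseudo_outerplanar G \<and>
    \<not> partitions_into_two_forests G"
proof (intro exI conjI)
  show "simple_graph (glued_K4 n)"
    using assms by (rule simple_graph_glued_K4)
  show "order (glued_K4 n) = n"
    by (simp add: order_def glued_K4_verts)
  show "two_connected (glued_K4 n)"
    using assms by (rule two_connected_glued_K4)
  show "pseudo_outerplanar (glued_K4 n)"
    using assms simple_graph_glued_K4 pseudo_outerplanar_drawable_glued_K4
      pseudo_outerplanar_drawable_subgraph
    unfolding pseudo_outerplanar_def block_def by blast
  show "\<not> partitions_into_two_forests (glued_K4 n)"
    using assms by (rule not_partitions_glued_K4)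
qed

end
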